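(* Let $x$ be a $\lambda$-variable, let $n$ be a natural number and let $M_1,\dots,M_n$ be terms of the symmetric $\lambda\mu$-calculus. If $M_1,\dots,M_n$ are in $SN$, then $(x\; M_1 \dots M_n) \in SN$.
   Context: Terms of the (untyped) symmetric $\lambda\mu$-calculus are given by the grammar $\mathcal T ::= x \mid \lambda x\,\mathcal T \mid (\mathcal T\;\mathcal T) \mid \mu\alpha\,\mathcal T \mid (\alpha\;\mathcal T)$, where $x,y,\dots$ range over $\lambda$-variables and $\alpha,\beta,\dots$ over $\mu$-variables ($\lambda x$ binds $x$, $\mu\alpha$ binds $\alpha$; terms are taken up to renaming of bound variables, and substitutions are capture-avoiding). Application associates to the left: $(M\;N_1\dots N_n)$ means $((M\;N_1)\dots N_n)$. One-step reduction $\triangleright$ is the closure under all term contexts of the three rules ($\beta$) $(\lambda x M\;N)\triangleright M[x:=N]$; ($\mu$) $(\mu\alpha M\;N)\triangleright \mu\alpha\, M[\alpha=_r N]$; ($\mu'$) $(M\;\mu\alpha N)\triangleright \mu\alpha\, N[\alpha=_l M]$. Here $M[\alpha=_r N]$ is obtained from $M$ by (recursively) replacing each sub-term of $M$ of the form $(\alpha\;U)$ ($\alpha$ free) by $(\alpha\;(U\;N))$, and $N[\alpha=_l M]$ is obtained from $N$ by (recursively) replacing each sub-term of $N$ of the form $(\alpha\;U)$ by $(\alpha\;(M\;U))$. $SN$ is the set of terms having no infinite $\triangleright$-reduction sequence. *)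

theory Defs
  imports Main
begin

text \<open>
  Terms of the untyped symmetric lambda-mu-calculus up to renaming of bound variables, in
  de Bruijn notation. Lambda-variables and mu-variables are indexed separately: \<open>Lam\<close> binds
  lambda-index 0 of its body and leaves mu-indices alone, \<open>Mu\<close> binds mu-index 0 of its body
  and leaves lambda-indices alone. Indices pointing beyond all enclosing binders are free
  variables. \<open>Named \<alpha> M\<close> stands for \<open>(\<alpha> M)\<close>; the body of a \<open>Mu\<close> need not be of this form.
\<close>

datatype trm =
    Var nat
  | Lam trm
  | App trm trm
  | Mu trm
  | Named nat trm

primrec lift_lam :: "nat \<Rightarrow> trm \<Rightarrow> trm" where
  "lift_lam k (Var i) = Var (if i < k then i else Suc i)"
| "lift_lam k (Lam M) = Lam (lift_lam (Suc k) M)"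
| "lift_lam k (App M N) = App (lift_lam k M) (lift_lam k N)"
| "lift_lam k (Mu M) = Mu (lift_lam k M)"
| "lift_lam k (Named \<alpha> M) = Named \<alpha> (lift_lam k M)"

primrec lift_mu :: "nat \<Rightarrow> trm \<Rightarrow> trm" where
  "lift_mu k (Var i) = Var i"
| "lift_mu k (Lam M) = Lam (lift_mu k M)"
| "lift_mu k (App M N) = App (lift_mu k M) (lift_mu k N)"
| "lift_mu k (Mu M) = Mu (lift_mu (Suc k) M)"
| "lift_mu k (Named \<alpha> M) = Named (if \<alpha> < k then \<alpha> else Suc \<alpha>) (lift_mu k M)"

text \<open>
  \<open>subst k N M\<close> is \<open>M[x := N]\<close> for the variable \<open>x\<close> with lambda-index \<open>k\<close>. The binder of \<open>x\<close>
  disappears in a beta-step, so larger lambda-indices are decremented.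
\<close>

primrec subst :: "nat \<Rightarrow> trm \<Rightarrow> trm \<Rightarrow> trm" where
  "subst k N (Var i) = (if i < k then Var i else if i = k then N else Var (i - 1))"
| "subst k N (Lam M) = Lam (subst (Suc k) (lift_lam 0 N) M)"
| "subst k N (App M M') = App (subst k N M) (subst k N M')"
| "subst k N (Mu M) = Mu (subst k (lift_mu 0 N) M)"
| "subst k N (Named \<alpha> M) = Named \<alpha> (subst k N M)"

text \<open>
  \<open>subst_r \<alpha> N M\<close> is \<open>M[\<alpha> =\<^sub>r N]\<close> and \<open>subst_l \<alpha> N M\<close> is \<open>M[\<alpha> =\<^sub>l N]\<close>. The mu-variable \<open>\<alpha>\<close>
  survives these substitutions, so no index is decremented.
\<close>

primrec subst_r :: "nat \<Rightarrow> trm \<Rightarrow> trm \<Rightarrow> trm" where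
  "subst_r \<alpha> N (Var i) = Var i"
| "subst_r \<alpha> N (Lam M) = Lam (subst_r \<alpha> (lift_lam 0 N) M)"
| "subst_r \<alpha> N (App M M') = App (subst_r \<alpha> N M) (subst_r \<alpha> N M')"
| "subst_r \<alpha> N (Mu M) = Mu (subst_r (Suc \<alpha>) (lift_mu 0 N) M)"
| "subst_r \<alpha> N (Named \<beta> U) =
    Named \<beta> (if \<beta> = \<alpha> then App (subst_r \<alpha> N U) N else subst_r \<alpha> N U)"

primrec subst_l :: "nat \<Rightarrow> trm \<Rightarrow> trm \<Rightarrow> trm" where
  "subst_l \<alpha> N (Var i) = Var i"
| "subst_l \<alpha> N (Lam M) = Lam (subst_l \<alpha> (lift_lam 0 N) M)"
| "subst_l \<alpha> N (App M M') = App (subst_l \<alpha> N M) (subst_l \<alpha> N M')"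
| "subst_l \<alpha> N (Mu M) = Mu (subst_l (Suc \<alpha>) (lift_mu 0 N) M)"
| "subst_l \<alpha> N (Named \<beta> U) =
    Named \<beta> (if \<beta> = \<alpha> then App N (subst_l \<alpha> N U) else subst_l \<alpha> N U)"

text \<open>
  In the rules \<open>mu\<close> and \<open>mu'\<close> the argument moves under the binder \<open>\<mu>\<alpha>\<close>, where \<open>\<alpha>\<close> has index 0,
  and is therefore lifted.
\<close>

inductive red :: "trm \<Rightarrow> trm \<Rightarrow> bool" (infix \<open>\<triangleright>\<close> 50) where
  beta: "App (Lam M) N \<triangleright> subst 0 N M"
| mu: "App (Mu M) N \<triangleright> Mu (subst_r 0 (lift_mu 0 N) M)"
| mu': "App M (Mu N) \<triangleright> Mu (subst_l 0 (lift_mu 0 M) N)"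
| Lam: "M \<triangleright> M' \<Longrightarrow> Lam M \<triangleright> Lam M'"
| App1: "M \<triangleright> M' \<Longrightarrow> App M N \<triangleright> App M' N"
| App2: "N \<triangleright> N' \<Longrightarrow> App M N \<triangleright> App M N'"
| Mu: "M \<triangleright> M' \<Longrightarrow> Mu M \<triangleright> Mu M'"
| Named: "M \<triangleright> M' \<Longrightarrow> Named \<alpha> M \<triangleright> Named \<alpha> M'"

definition SN :: "trm set" where
  "SN = {M. \<not> (\<exists>f :: nat \<Rightarrow> trm. f 0 = M \<and> (\<forall>i. f i \<triangleright> f (Suc i)))}"

abbreviation apps :: "trm \<Rightarrow> trm list \<Rightarrow> trm" where
  "apps M Ns \<equiv> foldl App M Ns"

end

theory Submission imports Defs begin

text \<open>
  A spine \<open>x Y\<^sub>1 \<dots> Y\<^sub>n\<close> never reduces to an abstraction, so it can only fail to be strongly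
  normalizing because some \<open>Y\<^sub>i\<close> reduces to \<open>\<mu>\<beta> V\<close> and captures its context
  \<open>E = x Y\<^sub>1 \<dots> [] \<dots> Y\<^sub>n\<close>, turning each \<open>(\<beta> U)\<close> in \<open>V\<close> into \<open>(\<beta> E[U])\<close>. The argument \<open>U\<close> has then been
  hit by the same substitution, so the induction runs on closures \<open>T\<sigma>\<close> of strongly normalizing
  terms \<open>T\<close>, where \<open>\<sigma>\<close> assigns contexts to mu-variables, and is measured by the underlying \<open>T\<close> in
  the well-founded order \<open><\<close> generated by reducts and subterms. A context \<open>E\<close> is admissible for \<open>T\<close>
  if \<open>E[U\<tau>]\<close> is strongly normalizing for all \<open>U < T\<close> and all \<open>\<tau>\<close> admissible for \<open>U\<close>, a recursion
  on \<open><\<close>. Closures of \<open>T\<close> by admissible contexts are strongly normalizing. A well-founded induction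
  on the tuple \<open>(T\<^sub>1, \<dots>, T\<^sub>n)\<close> then gives the same for spines of closures \<open>x (T\<^sub>1\<sigma>\<^sub>1) \<dots> (T\<^sub>n\<sigma>\<^sub>n)\<close>: if
  \<open>T\<^sub>i\<close> reduces to \<open>\<mu>\<beta> V\<close>, then replacing \<open>T\<^sub>i\<close> by some \<open>U < V\<close> makes the tuple smaller, which says that
  the captured context is admissible for \<open>V\<close>.
\<close>

section \<open>Contexts and simultaneous substitution\<close>

text \<open>An application with a hole: the hole is the argument in \<open>L N\<close> and the
  operator in \<open>R N\<close>. The type parameter supplies \<open>map_frame\<close> and
  \<open>rel_frame\<close>, which carry substitutions and reduction over to contexts.\<close>

datatype 'a frame = L 'a | R 'a

primrec plug :: "trm frame list \<Rightarrow> trm \<Rightarrow> trm" where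
  "plug [] U = U"
| "plug (f # E) U = plug E (case f of L N \<Rightarrow> App N U | R N \<Rightarrow> App U N)"

abbreviation fmap :: "('a \<Rightarrow> 'b) \<Rightarrow> 'a frame list \<Rightarrow> 'b frame list" where
  "fmap f \<equiv> map (map_frame f)"

text \<open>
  Simultaneous substitution: \<open>s\<close> replaces lambda-variables, \<open>r\<close> renames mu-variables, and the body of
  \<open>(\<alpha> U)\<close> is plugged into the context \<open>\<sigma> \<alpha>\<close>, whose frames are listed innermost first. All five
  operations of the calculus are instances, so a single composition law yields every commutation
  property.
\<close>

primrec psub :: "(nat \<Rightarrow> trm) \<Rightarrow> (nat \<Rightarrow> nat) \<Rightarrow> (nat \<Rightarrow> trm frame list) \<Rightarrow> trm \<Rightarrow> trm" where
  "psub s r \<sigma> (Var i) = s i"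
| "psub s r \<sigma> (Lam M) =
    Lam (psub (case_nat (Var 0) (\<lambda>i. lift_lam 0 (s i))) r (\<lambda>\<alpha>. fmap (lift_lam 0) (\<sigma> \<alpha>)) M)"
| "psub s r \<sigma> (App M N) = App (psub s r \<sigma> M) (psub s r \<sigma> N)"
| "psub s r \<sigma> (Mu M) =
    Mu (psub (\<lambda>i. lift_mu 0 (s i)) (case_nat 0 (\<lambda>\<alpha>. Suc (r \<alpha>)))
      (case_nat [] (\<lambda>\<alpha>. fmap (lift_mu 0) (\<sigma> \<alpha>))) M)"
| "psub s r \<sigma> (Named \<alpha> M) = Named (r \<alpha>) (plug (\<sigma> \<alpha>) (psub s r \<sigma> M))"

abbreviation ren :: "(nat \<Rightarrow> nat) \<Rightarrow> (nat \<Rightarrow> nat) \<Rightarrow> trm \<Rightarrow> trm" where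
  "ren \<rho> r \<equiv> psub (\<lambda>i. Var (\<rho> i)) r (\<lambda>_. [])"

lemma plug_append [simp]: "plug (E @ F) U = plug F (plug E U)"
  by (induction E arbitrary: U) auto

lemma psub_cong_arg:
  "s = s' \<Longrightarrow> r = r' \<Longrightarrow> \<sigma> = \<sigma>' \<Longrightarrow> psub s r \<sigma> M = psub s' r' \<sigma>' M"
  by simp

section \<open>The operations of the calculus as instances\<close>

lemma lift_lam_psub: "lift_lam k M = ren (\<lambda>i. if i < k then i else Suc i) (\<lambda>\<alpha>. \<alpha>) M"
proof (induction M arbitrary: k)
  case (Lam M)
  show ?case by (auto simp: Lam intro!: psub_cong_arg split: nat.splits)
next
  case (Mu M)
  show ?case by (auto simp: Mu intro!: psub_cong_arg split: nat.splits)
qed auto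

lemma lift_mu_psub: "lift_mu k M = ren (\<lambda>i. i) (\<lambda>i. if i < k then i else Suc i) M"
proof (induction M arbitrary: k)
  case (Lam M)
  show ?case by (auto simp: Lam intro!: psub_cong_arg split: nat.splits)
next
  case (Mu M)
  show ?case by (auto simp: Mu intro!: psub_cong_arg split: nat.splits)
qed auto

lemma lift_lam0: "lift_lam 0 = ren Suc (\<lambda>\<alpha>. \<alpha>)"
  by (rule ext) (simp add: lift_lam_psub)

lemma lift_mu0: "lift_mu 0 = ren (\<lambda>i. i) Suc"
  by (rule ext) (simp add: lift_mu_psub)

lemma subst_psub:
  "subst k N M = psub (\<lambda>i. if i < k then Var i else if i = k then N else Var (i - 1)) (\<lambda>\<alpha>. \<alpha>) (\<lambda>_. []) M"
proof (induction M arbitrary: k N)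
  case (Lam M)
  show ?case by (auto simp: Lam intro!: psub_cong_arg split: nat.splits)
next
  case (Mu M)
  show ?case by (auto simp: Mu intro!: psub_cong_arg split: nat.splits)
qed auto

lemma subst_r_psub: "subst_r \<alpha> N M = psub Var (\<lambda>\<alpha>. \<alpha>) ((\<lambda>_. [])(\<alpha> := [R N])) M"
proof (induction M arbitrary: \<alpha> N)
  case (Lam M)
  show ?case by (auto simp: Lam intro!: psub_cong_arg split: nat.splits)
next
  case (Mu M)
  show ?case by (auto simp: Mu intro!: psub_cong_arg split: nat.splits)
qed auto

lemma subst_l_psub: "subst_l \<alpha> N M = psub Var (\<lambda>\<alpha>. \<alpha>) ((\<lambda>_. [])(\<alpha> := [L N])) M"
proof (induction M arbitrary: \<alpha> N)
  case (Lam M)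
  show ?case by (auto simp: Lam intro!: psub_cong_arg split: nat.splits)
next
  case (Mu M)
  show ?case by (auto simp: Mu intro!: psub_cong_arg split: nat.splits)
qed auto

section \<open>Composition of substitutions\<close>

lemma psub_plug: "psub s r \<sigma> (plug E U) = plug (fmap (psub s r \<sigma>) E) (psub s r \<sigma> U)"
  by (induction E arbitrary: U) (auto split: frame.splits)

text \<open>The general composition law needs commutation with lifting at every binder, and liftings
  are renamings. So the case of renaming first is settled here, and the case of renaming last is
  built on it.\<close>

lemma psub_ren: "psub s r \<sigma> (ren \<rho> r' M) = psub (\<lambda>i. s (\<rho> i)) (\<lambda>\<alpha>. r (r' \<alpha>)) (\<lambda>\<alpha>. \<sigma> (r' \<alpha>)) M"
proof (induction M arbitrary: s r \<sigma> \<rho> r')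
  case (Lam M)
  \<comment> \<open>Under a \<open>Lam\<close> a renaming stays a renaming, so the hypothesis for
    \<open>ren\<close> applies to the body.\<close>
  have *: "case_nat (Var 0) (\<lambda>i. lift_lam 0 (Var (\<rho> i))) = (\<lambda>i. Var (case_nat 0 (\<lambda>i. Suc (\<rho> i)) i))"
    by (auto split: nat.splits)
  show ?case unfolding psub.simps * list.map Lam
    by (auto intro!: psub_cong_arg split: nat.splits)
next
  case (Mu M)
  have *: "case_nat [] (\<lambda>\<alpha>. []) = (\<lambda>_. [])" by (auto split: nat.splits)
  show ?case unfolding psub.simps lift_mu.simps list.map * Mu
    by (auto intro!: psub_cong_arg split: nat.splits)
qed auto

lemma ren_psub:
  "ren \<rho> r' (psub s r \<sigma> M) = psub (\<lambda>i. ren \<rho> r' (s i)) (\<lambda>\<alpha>. r' (r \<alpha>)) (\<lambda>\<alpha>. fmap (ren \<rho> r') (\<sigma> \<alpha>)) M"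
proof (induction M arbitrary: s r \<sigma> \<rho> r')
  case (Lam M)
  have *: "case_nat (Var 0) (\<lambda>i. lift_lam 0 (Var (\<rho> i))) = (\<lambda>i. Var (case_nat 0 (\<lambda>i. Suc (\<rho> i)) i))"
    by (auto split: nat.splits)
  show ?case unfolding psub.simps * list.map Lam
    by (auto simp: lift_lam0 psub_ren o_def frame.map_comp intro!: psub_cong_arg split: nat.splits)
next
  case (Mu M)
  have *: "case_nat [] (\<lambda>\<alpha>. []) = (\<lambda>_. [])" by (auto split: nat.splits)
  show ?case unfolding psub.simps lift_mu.simps list.map * Mu
    by (auto simp: lift_mu0 psub_ren o_def frame.map_comp intro!: psub_cong_arg split: nat.splits)
qed (auto simp: psub_plug)

text \<open>A body named \<alpha> first enters its context under the first substitution, transformed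
  by the second, and then the context that the second assigns to the new name. Contexts list inner
  frames first, so this is an append.\<close>

lemma psub_psub:
  "psub s2 r2 \<sigma>2 (psub s1 r1 \<sigma>1 M) =
   psub (\<lambda>i. psub s2 r2 \<sigma>2 (s1 i)) (\<lambda>\<alpha>. r2 (r1 \<alpha>)) (\<lambda>\<alpha>. fmap (psub s2 r2 \<sigma>2) (\<sigma>1 \<alpha>) @ \<sigma>2 (r1 \<alpha>)) M"
proof (induction M arbitrary: s1 r1 \<sigma>1 s2 r2 \<sigma>2)
  case (Lam M)
  show ?case unfolding psub.simps Lam
    by (auto simp: lift_lam0 psub_ren ren_psub o_def frame.map_comp intro!: psub_cong_arg split: nat.splits)
next
  case (Mu M)
  show ?case unfolding psub.simps Mu
    by (auto simp: lift_mu0 psub_ren ren_psub o_def frame.map_comp intro!: psub_cong_arg split: nat.splits)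
qed (auto simp: psub_plug)

lemma psub_id [simp]: "psub Var (\<lambda>\<alpha>. \<alpha>) (\<lambda>_. []) M = M"
proof (induction M)
  case (Lam M)
  have *: "case_nat (Var 0) (\<lambda>i. lift_lam 0 (Var i)) = Var" by (auto split: nat.splits)
  show ?case using Lam by (simp add: * del: lift_lam.simps)
next
  case (Mu M)
  have *: "case_nat [] (\<lambda>\<alpha>. []) = (\<lambda>_. [])" "case_nat 0 Suc = (\<lambda>x. x)" by (auto split: nat.splits)
  show ?case using Mu by (simp add: *)
qed auto

lemma psub_subst:
  "psub s r \<sigma> (subst 0 N M) = subst 0 (psub s r \<sigma> N)
     (psub (case_nat (Var 0) (\<lambda>i. lift_lam 0 (s i))) r (\<lambda>\<alpha>. fmap (lift_lam 0) (\<sigma> \<alpha>)) M)"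
  by (auto simp: subst_psub psub_psub psub_ren lift_lam0 o_def frame.map_comp frame.map_ident
      intro!: psub_cong_arg split: nat.splits)

text \<open>Under the binder, index 0 has the empty context, so it receives the new frame only. The
  lifted contexts avoid index 0, so \<open>subst_r\<close> leaves them alone.\<close>

lemma psub_subst_r:
  "psub (\<lambda>i. lift_mu 0 (s i)) (case_nat 0 (\<lambda>\<alpha>. Suc (r \<alpha>))) (case_nat [] (\<lambda>\<alpha>. fmap (lift_mu 0) (\<sigma> \<alpha>)))
     (subst_r 0 (lift_mu 0 N) M) =
   subst_r 0 (lift_mu 0 (psub s r \<sigma> N)) (psub (\<lambda>i. lift_mu 0 (s i)) (case_nat 0 (\<lambda>\<alpha>. Suc (r \<alpha>)))
      (case_nat [] (\<lambda>\<alpha>. fmap (lift_mu 0) (\<sigma> \<alpha>))) M)"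
  by (auto simp: subst_r_psub psub_psub psub_ren ren_psub lift_mu0 o_def frame.map_comp frame.map_ident
      intro!: psub_cong_arg split: nat.splits)

lemma psub_subst_l:
  "psub (\<lambda>i. lift_mu 0 (s i)) (case_nat 0 (\<lambda>\<alpha>. Suc (r \<alpha>))) (case_nat [] (\<lambda>\<alpha>. fmap (lift_mu 0) (\<sigma> \<alpha>)))
     (subst_l 0 (lift_mu 0 N) M) =
   subst_l 0 (lift_mu 0 (psub s r \<sigma> N)) (psub (\<lambda>i. lift_mu 0 (s i)) (case_nat 0 (\<lambda>\<alpha>. Suc (r \<alpha>)))
      (case_nat [] (\<lambda>\<alpha>. fmap (lift_mu 0) (\<sigma> \<alpha>))) M)"
  by (auto simp: subst_l_psub psub_psub psub_ren ren_psub lift_mu0 o_def frame.map_comp frame.map_ident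
      intro!: psub_cong_arg split: nat.splits)

section \<open>Reduction and substitution\<close>

abbreviation reds :: "trm \<Rightarrow> trm \<Rightarrow> bool" (infix \<open>\<triangleright>\<^sup>*\<close> 50) where
  "M \<triangleright>\<^sup>* N \<equiv> red\<^sup>*\<^sup>* M N"

lemma red_plug: "U \<triangleright> U' \<Longrightarrow> plug E U \<triangleright> plug E U'"
  by (induction E arbitrary: U U') (auto intro: red.intros split: frame.splits)

lemma red_psub: "M \<triangleright> M' \<Longrightarrow> psub s r \<sigma> M \<triangleright> psub s r \<sigma> M'"
proof (induction M M' arbitrary: s r \<sigma> rule: red.induct)
  case (beta M N)
  show ?case unfolding psub_subst psub.simps by (rule red.beta)
next
  case (mu M N)
  show ?case unfolding psub_subst_r psub.simps by (rule red.mu)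
next
  case (mu' M N)
  show ?case unfolding psub_subst_l psub.simps by (rule red.mu')
next
  case (Named M M' \<alpha>)
  show ?case unfolding psub.simps by (intro red.Named red_plug Named.IH)
qed (auto intro: red.intros)

lemma reds_psub: "M \<triangleright>\<^sup>* M' \<Longrightarrow> psub s r \<sigma> M \<triangleright>\<^sup>* psub s r \<sigma> M'"
  by (induction rule: rtranclp_induct) (auto intro: rtranclp.rtrancl_into_rtrancl red_psub)

lemma reds_Lam: "M \<triangleright>\<^sup>* M' \<Longrightarrow> Lam M \<triangleright>\<^sup>* Lam M'"
  by (induction rule: rtranclp_induct) (auto intro: rtranclp.rtrancl_into_rtrancl red.intros)

lemma reds_Mu: "M \<triangleright>\<^sup>* M' \<Longrightarrow> Mu M \<triangleright>\<^sup>* Mu M'"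
  by (induction rule: rtranclp_induct) (auto intro: rtranclp.rtrancl_into_rtrancl red.intros)

lemma reds_Named: "M \<triangleright>\<^sup>* M' \<Longrightarrow> Named \<alpha> M \<triangleright>\<^sup>* Named \<alpha> M'"
  by (induction rule: rtranclp_induct) (auto intro: rtranclp.rtrancl_into_rtrancl red.intros)

lemma reds_App: 
  assumes "M \<triangleright>\<^sup>* M'" "N \<triangleright>\<^sup>* N'" shows "App M N \<triangleright>\<^sup>* App M' N'"
proof -
  have "App M N \<triangleright>\<^sup>* App M' N" using assms(1)
    by (induction rule: rtranclp_induct) (auto intro: rtranclp.rtrancl_into_rtrancl red.intros)
  also have "App M' N \<triangleright>\<^sup>* App M' N'" using assms(2)
    by (induction rule: rtranclp_induct) (auto intro: rtranclp.rtrancl_into_rtrancl red.intros)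
  finally show ?thesis .
qed

lemma reds_plug: "list_all2 (rel_frame reds) E E' \<Longrightarrow> U \<triangleright>\<^sup>* U' \<Longrightarrow> plug E U \<triangleright>\<^sup>* plug E' U'"
proof (induction arbitrary: U U' rule: list_all2_induct)
  case (Cons f E f' E')
  then show ?case by (cases f; cases f') (auto intro: reds_App)
qed simp

lemma reds_lift_lam: "M \<triangleright>\<^sup>* M' \<Longrightarrow> lift_lam k M \<triangleright>\<^sup>* lift_lam k M'"
  unfolding lift_lam_psub by (rule reds_psub)

lemma reds_lift_mu: "M \<triangleright>\<^sup>* M' \<Longrightarrow> lift_mu k M \<triangleright>\<^sup>* lift_mu k M'"
  unfolding lift_mu_psub by (rule reds_psub)

lemma reds_fmap: 
  "list_all2 (rel_frame reds) E E' \<Longrightarrow> (\<And>M M'. M \<triangleright>\<^sup>* M' \<Longrightarrow> f M \<triangleright>\<^sup>* f M') \<Longrightarrow>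
   list_all2 (rel_frame reds) (fmap f E) (fmap f E')"
  by (auto simp: list.rel_map frame.rel_map elim!: list.rel_mono_strong frame.rel_mono_strong)

text \<open>Substituted material may be copied or erased, so one step in the environment becomes any
  number of steps in the result.\<close>

lemma reds_psub_env:
  "(\<And>i. s i \<triangleright>\<^sup>* s' i) \<Longrightarrow> (\<And>\<alpha>. list_all2 (rel_frame reds) (\<sigma> \<alpha>) (\<sigma>' \<alpha>)) \<Longrightarrow>
   psub s r \<sigma> M \<triangleright>\<^sup>* psub s' r \<sigma>' M"
proof (induction M arbitrary: s s' r \<sigma> \<sigma>')
  case (Lam M)
  show ?case unfolding psub.simps
    by (intro reds_Lam Lam.IH) (auto split: nat.split intro: reds_lift_lam reds_fmap Lam.prems)
next
  case (Mu M)
  show ?case unfolding psub.simps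
    by (intro reds_Mu Mu.IH) (auto split: nat.split intro: reds_lift_mu reds_fmap Mu.prems)
next
  case (Named \<alpha> M)
  show ?case unfolding psub.simps by (intro reds_Named reds_plug Named.IH Named.prems)
qed (auto intro: reds_App)

lemma reds_subst_arg: "N \<triangleright>\<^sup>* N' \<Longrightarrow> subst k N M \<triangleright>\<^sup>* subst k N' M"
  unfolding subst_psub by (rule reds_psub_env) auto

lemma reds_subst_r_arg: "N \<triangleright>\<^sup>* N' \<Longrightarrow> subst_r k N M \<triangleright>\<^sup>* subst_r k N' M"
  unfolding subst_r_psub by (rule reds_psub_env) auto

lemma reds_subst_l_arg: "N \<triangleright>\<^sup>* N' \<Longrightarrow> subst_l k N M \<triangleright>\<^sup>* subst_l k N' M"
  unfolding subst_l_psub by (rule reds_psub_env) auto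

lemma reds_subst: "M \<triangleright>\<^sup>* M' \<Longrightarrow> subst k N M \<triangleright>\<^sup>* subst k N M'"
  unfolding subst_psub by (rule reds_psub)

lemma reds_subst_r: "M \<triangleright>\<^sup>* M' \<Longrightarrow> subst_r k N M \<triangleright>\<^sup>* subst_r k N M'"
  unfolding subst_r_psub by (rule reds_psub)

lemma reds_subst_l: "M \<triangleright>\<^sup>* M' \<Longrightarrow> subst_l k N M \<triangleright>\<^sup>* subst_l k N M'"
  unfolding subst_l_psub by (rule reds_psub)

section \<open>Inversion of reduction sequences\<close>

inductive_cases red_VarE: "Var i \<triangleright> M"
inductive_cases red_LamE: "Lam M \<triangleright> M'"
inductive_cases red_MuE: "Mu M \<triangleright> M'"
inductive_cases red_NamedE: "Named \<alpha> M \<triangleright> M'"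
inductive_cases red_AppE [consumes 1, case_names beta mu mu' App1 App2]: "App M N \<triangleright> M'"

lemma reds_VarD: "Var i \<triangleright>\<^sup>* C \<Longrightarrow> C = Var i"
  by (induction rule: rtranclp_induct) (auto elim: red_VarE)

lemma reds_LamD: "Lam M \<triangleright>\<^sup>* C \<Longrightarrow> \<exists>M'. C = Lam M' \<and> M \<triangleright>\<^sup>* M'"
  by (induction rule: rtranclp_induct) (auto elim!: red_LamE intro: rtranclp.rtrancl_into_rtrancl)

lemma reds_MuD: "Mu M \<triangleright>\<^sup>* C \<Longrightarrow> \<exists>M'. C = Mu M' \<and> M \<triangleright>\<^sup>* M'"
  by (induction rule: rtranclp_induct) (auto elim!: red_MuE intro: rtranclp.rtrancl_into_rtrancl)

lemma reds_NamedD: "Named \<alpha> M \<triangleright>\<^sup>* C \<Longrightarrow> \<exists>M'. C = Named \<alpha> M' \<and> M \<triangleright>\<^sup>* M'"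
  by (induction rule: rtranclp_induct) (auto elim!: red_NamedE intro: rtranclp.rtrancl_into_rtrancl)

text \<open>Before the first contraction at the root, both sides reduce independently. Steps of the
  side that does not expose the binder can be postponed until after the contraction, so that side
  appears unreduced in the contractum.\<close>

lemma reds_AppD:
  assumes "App A B \<triangleright>\<^sup>* C"
  shows "(\<exists>A' B'. C = App A' B' \<and> A \<triangleright>\<^sup>* A' \<and> B \<triangleright>\<^sup>* B')
    \<or> (\<exists>W. A \<triangleright>\<^sup>* Lam W \<and> subst 0 B W \<triangleright>\<^sup>* C)
    \<or> (\<exists>W. A \<triangleright>\<^sup>* Mu W \<and> Mu (subst_r 0 (lift_mu 0 B) W) \<triangleright>\<^sup>* C)
    \<or> (\<exists>W. B \<triangleright>\<^sup>* Mu W \<and> Mu (subst_l 0 (lift_mu 0 A) W) \<triangleright>\<^sup>* C)"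
  using assms
proof (induction rule: rtranclp_induct)
  case (step C D)
  consider A' B' where "C = App A' B'" "A \<triangleright>\<^sup>* A'" "B \<triangleright>\<^sup>* B'"
    | W where "A \<triangleright>\<^sup>* Lam W" "subst 0 B W \<triangleright>\<^sup>* C"
    | W where "A \<triangleright>\<^sup>* Mu W" "Mu (subst_r 0 (lift_mu 0 B) W) \<triangleright>\<^sup>* C"
    | W where "B \<triangleright>\<^sup>* Mu W" "Mu (subst_l 0 (lift_mu 0 A) W) \<triangleright>\<^sup>* C"
    using step.IH by blast
  then show ?case
  proof cases
    case 1
    from step.hyps(2) show ?thesis unfolding 1(1)
    proof (cases rule: red_AppE)
      case (beta W)
      then show ?thesis using \<open>A \<triangleright>\<^sup>* A'\<close> reds_subst_arg[OF \<open>B \<triangleright>\<^sup>* B'\<close>] by blast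
    next
      case (mu W)
      then show ?thesis
        using \<open>A \<triangleright>\<^sup>* A'\<close> reds_Mu[OF reds_subst_r_arg[OF reds_lift_mu[OF \<open>B \<triangleright>\<^sup>* B'\<close>]]] by blast
    next
      case (mu' W)
      then show ?thesis
        using \<open>B \<triangleright>\<^sup>* B'\<close> reds_Mu[OF reds_subst_l_arg[OF reds_lift_mu[OF \<open>A \<triangleright>\<^sup>* A'\<close>]]] by blast
    next
      case (App1 A'')
      then show ?thesis
        using rtranclp.rtrancl_into_rtrancl[OF \<open>A \<triangleright>\<^sup>* A'\<close>] \<open>B \<triangleright>\<^sup>* B'\<close> by blast
    next
      case (App2 B'')
      then show ?thesis
        using rtranclp.rtrancl_into_rtrancl[OF \<open>B \<triangleright>\<^sup>* B'\<close>] \<open>A \<triangleright>\<^sup>* A'\<close> by blast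
    qed
  qed (use step.hyps(2) in \<open>blast intro: rtranclp.rtrancl_into_rtrancl\<close>)+
qed blast

text \<open>Both mu-rules yield a \<open>Mu\<close>, and reducts of a \<open>Mu\<close> stay one, so
  only \<beta> can lead to an abstraction.\<close>

lemma App_reds_LamD: "App A B \<triangleright>\<^sup>* Lam C \<Longrightarrow> \<exists>W. A \<triangleright>\<^sup>* Lam W \<and> subst 0 B W \<triangleright>\<^sup>* Lam C"
  by (drule reds_AppD) (auto dest: reds_MuD)

lemma App_reds_MuD: 
  "App A B \<triangleright>\<^sup>* Mu C \<Longrightarrow> (\<exists>W. A \<triangleright>\<^sup>* Lam W \<and> subst 0 B W \<triangleright>\<^sup>* Mu C)
    \<or> (\<exists>W. A \<triangleright>\<^sup>* Mu W \<and> subst_r 0 (lift_mu 0 B) W \<triangleright>\<^sup>* C)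
    \<or> (\<exists>W. B \<triangleright>\<^sup>* Mu W \<and> subst_l 0 (lift_mu 0 A) W \<triangleright>\<^sup>* C)"
  by (drule reds_AppD) (auto dest: reds_MuD)

section \<open>Strong normalization as accessibility\<close>

abbreviation sn :: "trm \<Rightarrow> bool" where
  "sn \<equiv> Wellfounded.accp (\<lambda>N M. M \<triangleright> N)"

lemma SN_iff_sn: "M \<in> SN \<longleftrightarrow> sn M"
proof
  assume SN: "M \<in> SN"
  show "sn M"
  proof (rule ccontr)
    assume M: "\<not> sn M"
    \<comment> \<open>Every inaccessible term has an inaccessible reduct, so dependent choice builds
      an infinite sequence from \<open>M\<close>.\<close>
    have "\<exists>f. \<forall>i. (\<not> sn (f i) \<and> (i = 0 \<longrightarrow> f i = M)) \<and> f i \<triangleright> f (Suc i)"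
    proof (rule dependent_nat_choice)
      show "\<exists>K. \<not> sn K \<and> (0 = (0::nat) \<longrightarrow> K = M)" using M by blast
      show "\<exists>N. (\<not> sn N \<and> (Suc i = 0 \<longrightarrow> N = M)) \<and> K \<triangleright> N"
        if "\<not> sn K \<and> (i = 0 \<longrightarrow> K = M)" for K i
        using that by (blast elim: not_accp_down)
    qed
    with SN show False by (auto simp: SN_def)
  qed
next
  assume "sn M"
  then show "M \<in> SN"
  proof (induction rule: accp_induct_rule)
    case (1 M)
    show ?case unfolding SN_def
    proof (safe)
      fix f :: "nat \<Rightarrow> trm" assume f: "M = f 0" "\<forall>i. f i \<triangleright> f (Suc i)"
      then have "f (Suc 0) \<in> SN" using 1 by blast
      moreover have "f (Suc 0) \<notin> SN" unfolding SN_def using f(2) by auto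
      ultimately show False by blast
    qed
  qed
qed

lemma snI: "(\<And>N. M \<triangleright> N \<Longrightarrow> sn N) \<Longrightarrow> sn M"
  by (blast intro: accp.accI)

lemma sn_red: "sn M \<Longrightarrow> M \<triangleright> N \<Longrightarrow> sn N"
  by (blast dest: accp_downward)

lemma sn_reds: "M \<triangleright>\<^sup>* N \<Longrightarrow> sn M \<Longrightarrow> sn N"
  by (induction rule: rtranclp_induct) (auto intro: sn_red)

lemma sn_reflect:
  assumes "sn (f M)" and "\<And>M N. M \<triangleright> N \<Longrightarrow> f M \<triangleright> f N"
  shows "sn M"
  using assms(1)
proof (induction "f M" arbitrary: M rule: accp_induct_rule)
  case 1
  show ?case by (rule snI) (rule 1(2)[OF assms(2)])
qed

lemma sn_Var: "sn (Var i)"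
  by (rule snI) (auto elim: red_VarE)

lemma sn_Lam: "sn M \<Longrightarrow> sn (Lam M)"
proof (induction rule: accp_induct_rule)
  case (1 M)
  then show ?case by - (rule snI, auto elim: red_LamE)
qed

lemma sn_Mu: "sn M \<Longrightarrow> sn (Mu M)"
proof (induction rule: accp_induct_rule)
  case (1 M)
  then show ?case by - (rule snI, auto elim: red_MuE)
qed

lemma sn_Named: "sn M \<Longrightarrow> sn (Named \<alpha> M)"
proof (induction rule: accp_induct_rule)
  case (1 M)
  then show ?case by - (rule snI, auto elim: red_NamedE)
qed

text \<open>When both sides normalize, an infinite reduction must contract the root. The hypotheses
  let one side run to its binder while the other is unreduced; in this form they pass to reducts of
  either side, which drives the nested induction on \<open>A\<close> and \<open>B\<close>.\<close>

lemma sn_App: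
  assumes "sn A" "sn B"
    and "\<And>W. A \<triangleright>\<^sup>* Lam W \<Longrightarrow> sn (subst 0 B W)"
    and "\<And>W. A \<triangleright>\<^sup>* Mu W \<Longrightarrow> sn (subst_r 0 (lift_mu 0 B) W)"
    and "\<And>W. B \<triangleright>\<^sup>* Mu W \<Longrightarrow> sn (subst_l 0 (lift_mu 0 A) W)"
  shows "sn (App A B)"
  using assms
proof (induction arbitrary: B rule: accp_induct_rule)
  case (1 A)
  note A = "1.IH"
  from "1.prems" show ?case
  proof (induction rule: accp_induct_rule)
    case (1 B)
    note prems = "1.prems"
    have A': "sn (App A' B)" if "A \<triangleright> A'" for A'
    proof (rule A[OF that])
      show "sn B" by (rule "1.hyps")
      fix W
      show "sn (subst 0 B W)" if "A' \<triangleright>\<^sup>* Lam W"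
        by (rule prems(1)[OF converse_rtranclp_into_rtranclp[of red, OF \<open>A \<triangleright> A'\<close> that]])
      show "sn (subst_r 0 (lift_mu 0 B) W)" if "A' \<triangleright>\<^sup>* Mu W"
        by (rule prems(2)[OF converse_rtranclp_into_rtranclp[of red, OF \<open>A \<triangleright> A'\<close> that]])
      show "sn (subst_l 0 (lift_mu 0 A') W)" if "B \<triangleright>\<^sup>* Mu W"
        by (rule sn_reds[OF reds_subst_l_arg[OF reds_lift_mu[OF r_into_rtranclp[of red, OF \<open>A \<triangleright> A'\<close>]]]])
          (rule prems(3)[OF that])
    qed
    have B': "sn (App A B')" if "B \<triangleright> B'" for B'
    proof (rule "1.IH"[OF that])
      fix W
      show "sn (subst 0 B' W)" if "A \<triangleright>\<^sup>* Lam W"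
        by (rule sn_reds[OF reds_subst_arg[OF r_into_rtranclp[of red, OF \<open>B \<triangleright> B'\<close>]]])
          (rule prems(1)[OF that])
      show "sn (subst_r 0 (lift_mu 0 B') W)" if "A \<triangleright>\<^sup>* Mu W"
        by (rule sn_reds[OF reds_subst_r_arg[OF reds_lift_mu[OF r_into_rtranclp[of red, OF \<open>B \<triangleright> B'\<close>]]]])
          (rule prems(2)[OF that])
      show "sn (subst_l 0 (lift_mu 0 A) W)" if "B' \<triangleright>\<^sup>* Mu W"
        by (rule prems(3)[OF converse_rtranclp_into_rtranclp[of red, OF \<open>B \<triangleright> B'\<close> that]])
    qed
    show ?case
    proof (rule snI)
      fix C assume "App A B \<triangleright> C"
      then show "sn C"
      proof (cases rule: red_AppE)
        case (beta W)
        then show ?thesis using prems(1) by blast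
      next
        case (mu W)
        then show ?thesis using sn_Mu[OF prems(2)] by blast
      next
        case (mu' W)
        then show ?thesis using sn_Mu[OF prems(3)] by blast
      qed (simp_all add: A' B')
    qed
  qed
qed

section \<open>The order by reducts and subterms\<close>

inductive child :: "trm \<Rightarrow> trm \<Rightarrow> bool" where
  "child M (Lam M)"
| "child M (App M N)"
| "child N (App M N)"
| "child M (Mu M)"
| "child M (Named \<alpha> M)"

text \<open>A step inside an immediate subterm is a step of the whole term. This commutation lets
  reducts and subterms be mixed in one well-founded order.\<close>

lemma child_red:
  assumes "child T U" "T \<triangleright> T'"
  shows "\<exists>U'. U \<triangleright> U' \<and> child T' U'"
  using assms(1)
proof cases
  case 1
  then show ?thesis using red.Lam[OF assms(2)] child.intros(1) by blast
next
  case (2 N)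
  then show ?thesis using red.App1[OF assms(2)] child.intros(2) by blast
next
  case (3 M)
  then show ?thesis using red.App2[OF assms(2)] child.intros(3) by blast
next
  case 4
  then show ?thesis using red.Mu[OF assms(2)] child.intros(4) by blast
next
  case (5 \<alpha>)
  then show ?thesis using red.Named[OF assms(2)] child.intros(5) by blast
qed

lemma subterm_red: "child\<^sup>*\<^sup>* T U \<Longrightarrow> T \<triangleright> T' \<Longrightarrow> \<exists>U'. U \<triangleright> U' \<and> child\<^sup>*\<^sup>* T' U'"
proof (induction rule: rtranclp_induct)
  case (step U V)
  then obtain U' where U': "U \<triangleright> U'" "child\<^sup>*\<^sup>* T' U'" by blast
  from child_red[OF step.hyps(2) U'(1)] U'(2) show ?case
    by (meson rtranclp.rtrancl_into_rtrancl)
qed blast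

lemma sn_child: "sn U \<Longrightarrow> child T U \<Longrightarrow> sn T"
proof (induction arbitrary: T rule: accp_induct_rule)
  case (1 U)
  show ?case
  proof (rule snI)
    fix T' assume "T \<triangleright> T'"
    then obtain U' where "U \<triangleright> U'" "child T' U'" using child_red[OF 1(3)] by blast
    then show "sn T'" by (rule 1(2))
  qed
qed

text \<open>Pairs list the smaller term first. The guard \<open>sn T\<close> leaves other terms
  without predecessors, so the order is well-founded on all terms.\<close>

definition below :: "(trm \<times> trm) set" where
  "below = {(U, T). sn T \<and> (T \<triangleright> U \<or> child U T)}\<^sup>+"

text \<open>Let \<open>T\<close> be a subterm of a normalizing \<open>U\<close>. A reduct of
  \<open>T\<close> is a subterm of a reduct of \<open>U\<close>, handled by induction on
  \<open>U\<close>; a child of \<open>T\<close> is still a subterm of \<open>U\<close>, handled by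
  structural induction on \<open>T\<close>.\<close>

lemma wf_below: "wf below"
proof -
  let ?B = "{(U, T). sn T \<and> (T \<triangleright> U \<or> child U T)}"
  have "T \<in> Wellfounded.acc ?B" if "sn U" "child\<^sup>*\<^sup>* T U" for T U
    using that
  proof (induction arbitrary: T rule: accp_induct_rule)
    case (1 U)
    have red: "T' \<in> Wellfounded.acc ?B" if "child\<^sup>*\<^sup>* T U" "T \<triangleright> T'" for T T'
      using subterm_red[OF that] "1.IH" by blast
    have step: "T \<in> Wellfounded.acc ?B"
      if "child\<^sup>*\<^sup>* T U" "\<And>V. child V T \<Longrightarrow> child\<^sup>*\<^sup>* V U \<Longrightarrow> V \<in> Wellfounded.acc ?B" for T
    proof (rule accI)
      fix V assume "(V, T) \<in> ?B"
      then show "V \<in> Wellfounded.acc ?B"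
        using red[OF that(1)] that(2) converse_rtranclp_into_rtranclp[of child V T U] that(1) by blast
    qed
    from "1.prems" show ?case
      by (induction T) (rule step, assumption, erule child.cases, simp_all)+
  qed
  moreover have "T \<in> Wellfounded.acc ?B" if "\<not> sn T" for T
    using that by - (rule accI, simp)
  ultimately have "wf ?B" by (intro acc_wfI) blast
  then show ?thesis unfolding below_def by (rule wf_trancl)
qed

lemma below_trans: "(V, U) \<in> below \<Longrightarrow> (U, T) \<in> below \<Longrightarrow> (V, T) \<in> below"
  unfolding below_def by (rule trancl_trans)

lemma below_red: "sn T \<Longrightarrow> T \<triangleright> U \<Longrightarrow> (U, T) \<in> below"
  unfolding below_def by (rule r_into_trancl) simp

lemma below_child: "sn T \<Longrightarrow> child U T \<Longrightarrow> (U, T) \<in> below"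
  unfolding below_def by (rule r_into_trancl) simp

lemma below_reds: "T \<triangleright>\<^sup>* U \<Longrightarrow> sn T \<Longrightarrow> U = T \<or> (U, T) \<in> below"
proof (induction rule: rtranclp_induct)
  case (step U V)
  have "(V, U) \<in> below" using below_red[OF sn_reds[OF step.hyps(1) step.prems] step.hyps(2)] .
  then show ?case using step.IH[OF step.prems] below_trans by blast
qed simp

lemma below_reds_red: "T \<triangleright>\<^sup>* U \<Longrightarrow> U \<triangleright> V \<Longrightarrow> sn T \<Longrightarrow> (V, T) \<in> below"
  using below_red[of U V] below_reds[of T U] below_trans[of V U T] sn_reds[of T U] by blast

lemma below_reds_child: "T \<triangleright>\<^sup>* U \<Longrightarrow> child V U \<Longrightarrow> sn T \<Longrightarrow> (V, T) \<in> below"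
  using below_child[of U V] below_reds[of T U] below_trans[of V U T] sn_reds[of T U] by blast

lemma sn_below: "(U, T) \<in> below \<Longrightarrow> sn U"
  unfolding below_def by (induction rule: converse_trancl_induct) (auto intro: sn_red sn_child)

section \<open>Binders exposed by closures\<close>

text \<open>
  Contexts sit below a \<open>Named\<close>, never at the root of a term, so a closure exposes a binder only if
  the underlying term does.
\<close>

lemma reds_ren_inv:
  "sn U \<Longrightarrow>
   (\<forall>C. psub (\<lambda>i. Var (\<rho> i)) r \<sigma> U \<triangleright>\<^sup>* Lam C \<longrightarrow> (\<exists>U'. U \<triangleright>\<^sup>* Lam U' \<and>
      psub (case_nat (Var 0) (\<lambda>i. lift_lam 0 (Var (\<rho> i)))) r (\<lambda>\<alpha>. fmap (lift_lam 0) (\<sigma> \<alpha>)) U' \<triangleright>\<^sup>* C)) \<and>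
   (\<forall>C. psub (\<lambda>i. Var (\<rho> i)) r \<sigma> U \<triangleright>\<^sup>* Mu C \<longrightarrow> (\<exists>U'. U \<triangleright>\<^sup>* Mu U' \<and>
      psub (\<lambda>i. lift_mu 0 (Var (\<rho> i))) (case_nat 0 (\<lambda>\<alpha>. Suc (r \<alpha>)))
        (case_nat [] (\<lambda>\<alpha>. fmap (lift_mu 0) (\<sigma> \<alpha>))) U' \<triangleright>\<^sup>* C))"
proof (induction U rule: wf_induct_rule[OF wf_below])
  case (1 U)
  let ?s = "psub (\<lambda>i. Var (\<rho> i)) r \<sigma>"
  let ?l = "psub (case_nat (Var 0) (\<lambda>i. lift_lam 0 (Var (\<rho> i)))) r (\<lambda>\<alpha>. fmap (lift_lam 0) (\<sigma> \<alpha>))"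
  let ?m = "psub (\<lambda>i. lift_mu 0 (Var (\<rho> i))) (case_nat 0 (\<lambda>\<alpha>. Suc (r \<alpha>)))
        (case_nat [] (\<lambda>\<alpha>. fmap (lift_mu 0) (\<sigma> \<alpha>)))"
  have IHl: "\<exists>V'. V \<triangleright>\<^sup>* Lam V' \<and> ?l V' \<triangleright>\<^sup>* C" if "(V, U) \<in> below" "?s V \<triangleright>\<^sup>* Lam C" for V C
    using 1(1)[OF that(1) sn_below[OF that(1)]] that(2) by blast
  have IHm: "\<exists>V'. V \<triangleright>\<^sup>* Mu V' \<and> ?m V' \<triangleright>\<^sup>* C" if "(V, U) \<in> below" "?s V \<triangleright>\<^sup>* Mu C" for V C
    using 1(1)[OF that(1) sn_below[OF that(1)]] that(2) by blast
  show ?case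
  proof (cases U)
    case (Var i)
    then show ?thesis by (auto dest: reds_VarD)
  next
    case (Lam V)
    have "?s U = Lam (?l V)" by (simp only: Lam psub.simps)
    then show ?thesis using Lam reds_LamD[of "?l V"]
      by (metis rtranclp.rtrancl_refl trm.distinct(11) trm.inject(2))
  next
    case (Mu V)
    then show ?thesis by (auto dest: reds_MuD)
  next
    case (Named \<alpha> V)
    then show ?thesis by (auto dest: reds_NamedD)
  next
    case (App M N)
    have M: "(M, U) \<in> below" and N: "(N, U) \<in> below"
      using \<open>sn U\<close> by (auto simp: App intro: below_child child.intros)
    \<comment> \<open>A \<beta>-redex exposed in the closure already exists in a reduct of
      \<open>U\<close>. Its contractum \<open>V\<close> is below \<open>U\<close>, and the closure
      of \<open>V\<close> leads to the contractum in the closure, so the induction continues with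
      \<open>V\<close>.\<close>
    have beta: "\<exists>V. U \<triangleright>\<^sup>* V \<and> (V, U) \<in> below \<and> ?s V \<triangleright>\<^sup>* subst 0 (?s N) W" if W: "?s M \<triangleright>\<^sup>* Lam W" for W
    proof -
      obtain M' where M': "M \<triangleright>\<^sup>* Lam M'" "?l M' \<triangleright>\<^sup>* W" using IHl[OF M W] by blast
      have 1: "U \<triangleright>\<^sup>* App (Lam M') N" unfolding App using M'(1) by (intro reds_App) auto
      have "U \<triangleright>\<^sup>* subst 0 N M'" using 1 red.beta by (rule rtranclp.rtrancl_into_rtrancl)
      moreover have "(subst 0 N M', U) \<in> below"
        using below_reds_red[OF 1 red.beta \<open>sn U\<close>] .
      moreover have "?s (subst 0 N M') \<triangleright>\<^sup>* subst 0 (?s N) W"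
        unfolding psub_subst using M'(2) by (rule reds_subst)
      ultimately show ?thesis by blast
    qed
    show ?thesis
    proof (intro conjI allI impI)
      fix C assume "?s U \<triangleright>\<^sup>* Lam C"
      then have "App (?s M) (?s N) \<triangleright>\<^sup>* Lam C" by (simp add: App)
      from App_reds_LamD[OF this] obtain W where W: "?s M \<triangleright>\<^sup>* Lam W" "subst 0 (?s N) W \<triangleright>\<^sup>* Lam C"
        by blast
      obtain V where V: "U \<triangleright>\<^sup>* V" "(V, U) \<in> below" "?s V \<triangleright>\<^sup>* subst 0 (?s N) W"
        using beta[OF W(1)] by blast
      from V(3) W(2) have "?s V \<triangleright>\<^sup>* Lam C" by (rule rtranclp_trans)
      from IHl[OF V(2) this] V(1) show "\<exists>U'. U \<triangleright>\<^sup>* Lam U' \<and> ?l U' \<triangleright>\<^sup>* C" by (meson rtranclp_trans)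
    next
      fix C assume "?s U \<triangleright>\<^sup>* Mu C"
      then have "App (?s M) (?s N) \<triangleright>\<^sup>* Mu C" by (simp add: App)
      from App_reds_MuD[OF this]
      consider W where "?s M \<triangleright>\<^sup>* Lam W" "subst 0 (?s N) W \<triangleright>\<^sup>* Mu C"
        | W where "?s M \<triangleright>\<^sup>* Mu W" "subst_r 0 (lift_mu 0 (?s N)) W \<triangleright>\<^sup>* C"
        | W where "?s N \<triangleright>\<^sup>* Mu W" "subst_l 0 (lift_mu 0 (?s M)) W \<triangleright>\<^sup>* C"
        by blast
      then show "\<exists>U'. U \<triangleright>\<^sup>* Mu U' \<and> ?m U' \<triangleright>\<^sup>* C"
      proof cases
        case (1 W)
        obtain V where V: "U \<triangleright>\<^sup>* V" "(V, U) \<in> below" "?s V \<triangleright>\<^sup>* subst 0 (?s N) W"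
          using beta[OF 1(1)] by blast
        from V(3) 1(2) have "?s V \<triangleright>\<^sup>* Mu C" by (rule rtranclp_trans)
        from IHm[OF V(2) this] V(1) show ?thesis by (meson rtranclp_trans)
      next
        \<comment> \<open>Here the contractum is itself a \<open>Mu\<close>, so the hypothesis for
          \<open>M\<close> suffices.\<close>
        case (2 W)
        obtain M' where M': "M \<triangleright>\<^sup>* Mu M'" "?m M' \<triangleright>\<^sup>* W" using IHm[OF M 2(1)] by blast
        have 1: "U \<triangleright>\<^sup>* App (Mu M') N" unfolding App using M'(1) by (intro reds_App) auto
        have "U \<triangleright>\<^sup>* Mu (subst_r 0 (lift_mu 0 N) M')"
          using 1 red.mu by (rule rtranclp.rtrancl_into_rtrancl)
        moreover have "?m (subst_r 0 (lift_mu 0 N) M') \<triangleright>\<^sup>* C"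
          unfolding psub_subst_r using reds_subst_r[OF M'(2)] 2(2) by (rule rtranclp_trans)
        ultimately show ?thesis by blast
      next
        case (3 W)
        obtain N' where N': "N \<triangleright>\<^sup>* Mu N'" "?m N' \<triangleright>\<^sup>* W" using IHm[OF N 3(1)] by blast
        have 1: "U \<triangleright>\<^sup>* App M (Mu N')" unfolding App using N'(1) by (intro reds_App) auto
        have "U \<triangleright>\<^sup>* Mu (subst_l 0 (lift_mu 0 M) N')"
          using 1 red.mu' by (rule rtranclp.rtrancl_into_rtrancl)
        moreover have "?m (subst_l 0 (lift_mu 0 M) N') \<triangleright>\<^sup>* C"
          unfolding psub_subst_l using reds_subst_l[OF N'(2)] 3(2) by (rule rtranclp_trans)
        ultimately show ?thesis by blast
      qed
    qed
  qed
qed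

section \<open>Closures and admissible contexts\<close>

text \<open>
  Lambda- and mu-renamings are built into closures and into admissibility because contexts are lifted
  when a substitution passes under a binder.
\<close>

function clos :: "trm \<Rightarrow> trm set" where
  "clos T = {psub (\<lambda>i. Var (\<rho> i)) r \<sigma> T | \<rho> r \<sigma>.
     \<forall>\<alpha> U. (U, T) \<in> below \<longrightarrow> (\<forall>Y \<in> clos U. \<forall>\<rho>' r'. sn (plug (fmap (ren \<rho>' r') (\<sigma> \<alpha>)) Y))}"
  by auto
termination by (relation below) (simp_all add: wf_below)

declare clos.simps [simp del]

text \<open>The condition that \<open>clos\<close> places on each context. The two notions depend on
  each other, so it is written out in the recursion and named only here.\<close>

definition admissible :: "trm \<Rightarrow> trm frame list \<Rightarrow> bool" where
  "admissible T E \<longleftrightarrow>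
     (\<forall>U. (U, T) \<in> below \<longrightarrow> (\<forall>Y \<in> clos U. \<forall>\<rho> r. sn (plug (fmap (ren \<rho> r) E) Y)))"

lemma closI: "(\<And>\<alpha>. admissible T (\<sigma> \<alpha>)) \<Longrightarrow> psub (\<lambda>i. Var (\<rho> i)) r \<sigma> T \<in> clos T"
  unfolding clos.simps[of T] admissible_def by blast

lemma closE:
  assumes "Y \<in> clos T"
  obtains \<rho> r \<sigma> where "Y = psub (\<lambda>i. Var (\<rho> i)) r \<sigma> T" "\<And>\<alpha>. admissible T (\<sigma> \<alpha>)"
  using assms unfolding clos.simps[of T] admissible_def by blast

lemma admissibleD:
  "admissible T E \<Longrightarrow> (U, T) \<in> below \<Longrightarrow> Y \<in> clos U \<Longrightarrow> sn (plug (fmap (ren \<rho> r) E) Y)"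
  by (simp add: admissible_def)

lemma admissible_mono: "admissible T E \<Longrightarrow> (U, T) \<in> below \<Longrightarrow> admissible U E"
  unfolding admissible_def using below_trans by blast

text \<open>Renamings compose, so the quantifier over renamings in admissibility absorbs one
  more.\<close>

lemma admissible_ren:
  assumes "admissible T E"
  shows "admissible T (fmap (ren \<rho> r) E)"
proof -
  have *: "fmap (ren \<rho>' r') (fmap (ren \<rho> r) E) = fmap (ren (\<lambda>i. \<rho>' (\<rho> i)) (\<lambda>\<alpha>. r' (r \<alpha>))) E" for \<rho>' r'
    by (simp add: frame.map_comp o_def psub_ren)
  show ?thesis unfolding admissible_def
    by (intro allI impI ballI) (simp only: *, rule admissibleD[OF assms])
qed

lemma admissible_plug:
  assumes "admissible T E" "(U, T) \<in> below" "Y \<in> clos U"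
  shows "sn (plug E Y)"
proof -
  have "sn (plug (fmap (ren (\<lambda>i. i) (\<lambda>\<alpha>. \<alpha>)) E) Y)" using assms by (rule admissibleD)
  moreover have "fmap (ren (\<lambda>i. i) (\<lambda>\<alpha>. \<alpha>)) E = E"
    by (intro map_idI frame.map_ident_strong psub_id)
  ultimately show ?thesis by simp
qed

lemma ren_clos: "Y \<in> clos T \<Longrightarrow> ren \<rho> r Y \<in> clos T"
  by (erule closE) (simp add: ren_psub closI admissible_ren)

lemma clos_under_Lam:
  assumes "\<And>\<alpha>. admissible T (\<sigma> \<alpha>)" "(V, T) \<in> below"
  shows "psub (case_nat (Var 0) (\<lambda>i. lift_lam 0 (Var (\<rho> i)))) r (\<lambda>\<alpha>. fmap (lift_lam 0) (\<sigma> \<alpha>)) V \<in> clos V"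
proof -
  have *: "case_nat (Var 0) (\<lambda>i. lift_lam 0 (Var (\<rho> i))) = (\<lambda>i. Var (case_nat 0 (\<lambda>i. Suc (\<rho> i)) i))"
    by (auto split: nat.splits)
  show ?thesis unfolding * unfolding lift_lam0
    by (intro closI admissible_ren admissible_mono[OF assms])
qed

text \<open>\<open>F\<close> is the context of the variable bound at index 0: empty when a
  substitution merely passes the binder, the captured context when a spine argument turns into a
  \<open>Mu\<close>.\<close>

lemma clos_under_Mu:
  assumes "\<And>\<alpha>. admissible T (\<sigma> \<alpha>)" "(V, T) \<in> below" "admissible V F"
  shows "psub (\<lambda>i. lift_mu 0 (Var (\<rho> i))) r (case_nat F (\<lambda>\<alpha>. fmap (lift_mu 0) (\<sigma> \<alpha>))) V \<in> clos V"
proof -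
  have "admissible V (case_nat F (\<lambda>\<alpha>. fmap (ren (\<lambda>i. i) Suc) (\<sigma> \<alpha>)) \<alpha>)" for \<alpha>
    using admissible_ren[OF admissible_mono[OF assms(1,2)]] assms(3) by (cases \<alpha>) auto
  from closI[OF this] show ?thesis unfolding lift_mu0 psub.simps by simp
qed

section \<open>Strong normalization of closures\<close>

text \<open>For a named body, normalization is what admissibility grants. For an application, a root
  redex of the closure comes from one in a reduct of \<open>T\<close>, whose contractum is below
  \<open>T\<close>, so the induction hypothesis covers its closure.\<close>

lemma sn_clos: "sn T \<Longrightarrow> Y \<in> clos T \<Longrightarrow> sn Y"
proof (induction T arbitrary: Y rule: wf_induct_rule[OF wf_below])
  case (1 T)
  obtain \<rho> r \<sigma> where Y: "Y = psub (\<lambda>i. Var (\<rho> i)) r \<sigma> T" and \<sigma>: "\<And>\<alpha>. admissible T (\<sigma> \<alpha>)"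
    using closE[OF \<open>Y \<in> clos T\<close>] by blast
  have IH: "sn Z" if "(U, T) \<in> below" "Z \<in> clos U" for U Z
    using "1.IH" that sn_below by blast
  have env: "psub (\<lambda>i. Var (\<rho> i)) r \<sigma> U \<in> clos U" if "(U, T) \<in> below" for U
    using that by (intro closI admissible_mono[OF \<sigma>])
  \<comment> \<open>For \<open>[]\<close>, admissibility only demands that closures of smaller terms
    normalize.\<close>
  have Nil: "admissible U []" if "(U, T) \<in> below" for U
    unfolding admissible_def using IH below_trans[OF _ that] by auto
  show ?case
  proof (cases T)
    case (Var i)
    then show ?thesis using Y sn_Var by simp
  next
    case (Lam V)
    have V: "(V, T) \<in> below" using below_child[OF \<open>sn T\<close>] child.intros(1) Lam by blast
    show ?thesis unfolding Y Lam psub.simps by (intro sn_Lam IH[OF V] clos_under_Lam[OF \<sigma> V])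
  next
    case (Mu V)
    have V: "(V, T) \<in> below" using below_child[OF \<open>sn T\<close>] child.intros(4) Mu by blast
    show ?thesis unfolding Y Mu psub.simps by (intro sn_Mu IH[OF V] clos_under_Mu[OF \<sigma> V] Nil[OF V])
  next
    case (Named \<alpha> V)
    have V: "(V, T) \<in> below" using below_child[OF \<open>sn T\<close>] child.intros(5) Named by blast
    show ?thesis unfolding Y Named psub.simps by (intro sn_Named admissible_plug[OF \<sigma> V] env V)
  next
    case (App M N)
    let ?s = "psub (\<lambda>i. Var (\<rho> i)) r \<sigma>"
    have M: "(M, T) \<in> below" and N: "(N, T) \<in> below"
      using below_child[OF \<open>sn T\<close>] child.intros(2,3) App by blast+
    have snM: "sn M" and snN: "sn N" using M N sn_below by blast+
    have *: "sn (?s U)" if "App M N \<triangleright>\<^sup>* V" "V \<triangleright> U" for U V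
      using that below_reds_red \<open>sn T\<close> App IH env by blast
    show ?thesis unfolding Y App psub.simps
    proof (rule sn_App)
      show "sn (?s M)" "sn (?s N)" using IH env M N by blast+
    next
      fix W assume "?s M \<triangleright>\<^sup>* Lam W"
      then obtain M' where M': "M \<triangleright>\<^sup>* Lam M'"
        "psub (case_nat (Var 0) (\<lambda>i. lift_lam 0 (Var (\<rho> i)))) r (\<lambda>\<alpha>. fmap (lift_lam 0) (\<sigma> \<alpha>)) M' \<triangleright>\<^sup>* W"
        using reds_ren_inv[OF snM] by blast
      have "sn (?s (subst 0 N M'))"
        by (rule *[OF reds_App[OF M'(1) rtranclp.rtrancl_refl] red.beta])
      then show "sn (subst 0 (?s N) W)"
        unfolding psub_subst by (rule sn_reds[OF reds_subst[OF M'(2)]])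
    next
      fix W assume "?s M \<triangleright>\<^sup>* Mu W"
      then obtain M' where M': "M \<triangleright>\<^sup>* Mu M'"
        "psub (\<lambda>i. lift_mu 0 (Var (\<rho> i))) (case_nat 0 (\<lambda>\<alpha>. Suc (r \<alpha>)))
          (case_nat [] (\<lambda>\<alpha>. fmap (lift_mu 0) (\<sigma> \<alpha>))) M' \<triangleright>\<^sup>* W"
        using reds_ren_inv[OF snM] by blast
      have "sn (?s (Mu (subst_r 0 (lift_mu 0 N) M')))"
        by (rule *[OF reds_App[OF M'(1) rtranclp.rtrancl_refl] red.mu])
      then have "sn (Mu (subst_r 0 (lift_mu 0 (?s N)) W))"
        unfolding psub.simps psub_subst_r by (rule sn_reds[OF reds_Mu[OF reds_subst_r[OF M'(2)]]])
      \<comment> \<open>The hypothesis treats the contractum as a whole; its body inherits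
        normalization because \<open>Mu\<close> preserves steps.\<close>
      then show "sn (subst_r 0 (lift_mu 0 (?s N)) W)" by (rule sn_reflect) (rule red.Mu)
    next
      fix W assume "?s N \<triangleright>\<^sup>* Mu W"
      then obtain N' where N': "N \<triangleright>\<^sup>* Mu N'"
        "psub (\<lambda>i. lift_mu 0 (Var (\<rho> i))) (case_nat 0 (\<lambda>\<alpha>. Suc (r \<alpha>)))
          (case_nat [] (\<lambda>\<alpha>. fmap (lift_mu 0) (\<sigma> \<alpha>))) N' \<triangleright>\<^sup>* W"
        using reds_ren_inv[OF snN] by blast
      have "sn (?s (Mu (subst_l 0 (lift_mu 0 M) N')))"
        by (rule *[OF reds_App[OF rtranclp.rtrancl_refl N'(1)] red.mu'])
      then have "sn (Mu (subst_l 0 (lift_mu 0 (?s M)) W))"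
        unfolding psub.simps psub_subst_l by (rule sn_reds[OF reds_Mu[OF reds_subst_l[OF N'(2)]]])
      then show "sn (subst_l 0 (lift_mu 0 (?s M)) W)" by (rule sn_reflect) (rule red.Mu)
    qed
  qed
qed

lemma clos_refl:
  assumes "sn T" shows "T \<in> clos T"
proof -
  have "admissible T []" unfolding admissible_def using sn_clos sn_below by auto
  then show ?thesis using closI[of T "\<lambda>_. []" "\<lambda>i. i" "\<lambda>\<alpha>. \<alpha>"] by simp
qed

section \<open>Captured contexts and spines\<close>

text \<open>
  The effect on \<open>M\<close> of \<open>\<mu>\<beta> M\<close> absorbing the surrounding context \<open>E\<close>, where \<open>\<beta>\<close> has index 0.
\<close>

abbreviation cap :: "trm frame list \<Rightarrow> trm \<Rightarrow> trm" where
  "cap E \<equiv> psub Var (\<lambda>\<alpha>. \<alpha>) ((\<lambda>_. [])(0 := fmap (lift_mu 0) E))"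

text \<open>Capturing one more argument is another mu-step. The frames of \<open>E\<close> are
  lifted past index 0, so \<open>subst_r\<close> only adds the outermost frame.\<close>

lemma cap_R: "cap (E @ [R N]) M = subst_r 0 (lift_mu 0 N) (cap E M)"
  by (auto simp: subst_r_psub psub_psub lift_mu0 psub_ren ren_psub o_def frame.map_comp intro!: psub_cong_arg)

text \<open>Index 0 had the empty context and acquires \<open>F\<close>, while the lifted contexts
  of the other variables do not mention it. A capture thus stays within the form of
  closures.\<close>

lemma cap_under_Mu:
  "cap F (psub (\<lambda>i. lift_mu 0 (Var (\<rho> i))) (case_nat 0 (\<lambda>\<alpha>. Suc (r \<alpha>)))
     (case_nat [] (\<lambda>\<alpha>. fmap (lift_mu 0) (\<sigma> \<alpha>))) M) =
   psub (\<lambda>i. lift_mu 0 (Var (\<rho> i))) (case_nat 0 (\<lambda>\<alpha>. Suc (r \<alpha>)))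
     (case_nat (fmap (lift_mu 0) F) (\<lambda>\<alpha>. fmap (lift_mu 0) (\<sigma> \<alpha>))) M"
  by (auto simp: psub_psub lift_mu0 psub_ren ren_psub o_def frame.map_comp
      intro!: psub_cong_arg split: nat.splits)

definition hole :: "nat \<Rightarrow> trm list \<Rightarrow> trm list \<Rightarrow> trm frame list" where
  "hole x As Bs = L (apps (Var x) As) # map R Bs"

lemma plug_map_R: "plug (map R Bs) U = apps U Bs"
  by (induction Bs arbitrary: U) auto

lemma plug_hole: "plug (hole x As Bs) U = apps (Var x) (As @ U # Bs)"
  by (simp add: hole_def plug_map_R)

lemma ren_apps: "ren \<rho> r (apps M As) = apps (ren \<rho> r M) (map (ren \<rho> r) As)"
  by (induction As arbitrary: M) auto

lemma ren_hole: "fmap (ren \<rho> r) (hole x As Bs) = hole (\<rho> x) (map (ren \<rho> r) As) (map (ren \<rho> r) Bs)"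
  by (simp add: hole_def ren_apps)

lemma spine_not_Lam: "\<not> apps (Var x) Ys \<triangleright>\<^sup>* Lam W"
proof (induction Ys arbitrary: W rule: rev_induct)
  case Nil
  then show ?case by (auto dest: reds_VarD)
next
  case (snoc Y Ys)
  then show ?case by (auto dest: App_reds_LamD)
qed

text \<open>Since a spine never reaches a \<open>Lam\<close>, its last application becomes a
  \<open>Mu\<close> either through the prefix, which then captures the last argument as outermost
  frame, or through the last argument, which captures the prefix.\<close>

lemma spine_reds_Mu:
  "apps (Var x) Ys \<triangleright>\<^sup>* Mu W \<Longrightarrow>
   \<exists>As Y Bs V. Ys = As @ Y # Bs \<and> Y \<triangleright>\<^sup>* Mu V \<and> cap (hole x As Bs) V \<triangleright>\<^sup>* W"
proof (induction Ys arbitrary: W rule: rev_induct)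
  case Nil
  then show ?case by (auto dest: reds_VarD)
next
  case (snoc Y Ys)
  let ?P = "apps (Var x) Ys"
  from snoc.prems have "App ?P Y \<triangleright>\<^sup>* Mu W" by simp
  from App_reds_MuD[OF this] spine_not_Lam
  consider W' where "?P \<triangleright>\<^sup>* Mu W'" "subst_r 0 (lift_mu 0 Y) W' \<triangleright>\<^sup>* W"
    | V where "Y \<triangleright>\<^sup>* Mu V" "subst_l 0 (lift_mu 0 ?P) V \<triangleright>\<^sup>* W" by blast
  then show ?case
  proof cases
    case 1
    obtain As Z Bs V where Z: "Ys = As @ Z # Bs" "Z \<triangleright>\<^sup>* Mu V" "cap (hole x As Bs) V \<triangleright>\<^sup>* W'"
      using snoc.IH[OF 1(1)] by blast
    have "hole x As (Bs @ [Y]) = hole x As Bs @ [R Y]" by (simp add: hole_def)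
    then have "cap (hole x As (Bs @ [Y])) V = subst_r 0 (lift_mu 0 Y) (cap (hole x As Bs) V)"
      using cap_R by metis
    then have "cap (hole x As (Bs @ [Y])) V \<triangleright>\<^sup>* W"
      using reds_subst_r[OF Z(3)] 1(2) by (metis rtranclp_trans)
    moreover have "Ys @ [Y] = As @ Z # (Bs @ [Y])" using Z(1) by simp
    ultimately show ?thesis using Z(2) by blast
  next
    case 2
    have "cap (hole x Ys []) V \<triangleright>\<^sup>* W" using 2(2) by (simp add: hole_def subst_l_psub)
    with 2(1) show ?thesis by blast
  qed
qed

lemma sn_spine:
  assumes "\<And>Y. Y \<in> set Ys \<Longrightarrow> sn Y"
    and "\<And>As Y Bs V. Ys = As @ Y # Bs \<Longrightarrow> Y \<triangleright>\<^sup>* Mu V \<Longrightarrow> sn (cap (hole x As Bs) V)"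
  shows "sn (apps (Var x) Ys)"
  using assms
proof (induction Ys rule: rev_induct)
  case Nil
  then show ?case by (simp add: sn_Var)
next
  case (snoc Y Ys)
  let ?P = "apps (Var x) Ys"
  have cap: "sn (subst_r 0 (lift_mu 0 Y) (cap (hole x As Bs) V))"
    if "Ys = As @ Z # Bs" "Z \<triangleright>\<^sup>* Mu V" for As Z Bs V
  proof -
    have "sn (cap (hole x As (Bs @ [Y])) V)" using that by (intro snoc.prems(2)[of As Z]) auto
    moreover have "hole x As (Bs @ [Y]) = hole x As Bs @ [R Y]" by (simp add: hole_def)
    ultimately show ?thesis using cap_R by metis
  qed
  have "sn (App ?P Y)"
  proof (rule sn_App)
    show "sn ?P"
    proof (rule snoc.IH)
      show "sn Z" if "Z \<in> set Ys" for Z using that snoc.prems(1) by simp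
      \<comment> \<open>The assumption covers the context extended by \<open>Y\<close>;
        \<open>subst_r\<close> preserves steps, so normalization passes back to the shorter
        context.\<close>
      show "sn (cap (hole x As Bs) V)" if "Ys = As @ Z # Bs" "Z \<triangleright>\<^sup>* Mu V" for As Z Bs V
        using cap[OF that] by (rule sn_reflect) (simp add: subst_r_psub red_psub)
    qed
    show "sn Y" using snoc.prems(1) by simp
  next
    fix W assume "?P \<triangleright>\<^sup>* Lam W"
    then show "sn (subst 0 Y W)" using spine_not_Lam by blast
  next
    fix W assume "?P \<triangleright>\<^sup>* Mu W"
    then obtain As Z Bs V where Z: "Ys = As @ Z # Bs" "Z \<triangleright>\<^sup>* Mu V" "cap (hole x As Bs) V \<triangleright>\<^sup>* W"
      using spine_reds_Mu by blast
    show "sn (subst_r 0 (lift_mu 0 Y) W)" by (rule sn_reds[OF reds_subst_r[OF Z(3)] cap[OF Z(1,2)]])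
  next
    fix W assume "Y \<triangleright>\<^sup>* Mu W"
    then have "sn (cap (hole x Ys []) W)" by (intro snoc.prems(2)) auto
    then show "sn (subst_l 0 (lift_mu 0 ?P) W)" by (simp add: hole_def subst_l_psub)
  qed
  then show ?case by simp
qed

text \<open>Induction on the list of underlying terms, of which one decreases while the others stay.
  The head \<open>x\<close> varies because the renamings in admissibility act on it.\<close>

lemma sn_spine_clos:
  "list_all2 (\<lambda>Y U. sn U \<and> Y \<in> clos U) Ys Us \<Longrightarrow> sn (apps (Var x) Ys)"
proof (induction Us arbitrary: Ys x rule: wf_induct_rule[OF iffD2[OF wf_listrel1_iff wf_below]])
  case (1 Us)
  show ?case
  proof (rule sn_spine)
    fix Y assume "Y \<in> set Ys"
    then show "sn Y" using "1.prems" sn_clos by (fastforce simp: list_all2_conv_all_nth in_set_conv_nth)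
  next
    fix As Y Bs V assume Ys: "Ys = As @ Y # Bs" and V: "Y \<triangleright>\<^sup>* Mu V"
    from "1.prems" obtain As' U Bs' where Us: "Us = As' @ U # Bs'"
      and As: "list_all2 (\<lambda>Y U. sn U \<and> Y \<in> clos U) As As'" and U: "sn U" "Y \<in> clos U"
      and Bs: "list_all2 (\<lambda>Y U. sn U \<and> Y \<in> clos U) Bs Bs'"
      unfolding Ys list_all2_append1 list_all2_Cons1 by blast
    obtain \<rho> r \<sigma> where Y: "Y = psub (\<lambda>i. Var (\<rho> i)) r \<sigma> U" and \<sigma>: "\<And>\<alpha>. admissible U (\<sigma> \<alpha>)"
      using closE[OF U(2)] by blast
    let ?m = "\<lambda>F. psub (\<lambda>i. lift_mu 0 (Var (\<rho> i))) (case_nat 0 (\<lambda>\<alpha>. Suc (r \<alpha>)))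
          (case_nat F (\<lambda>\<alpha>. fmap (lift_mu 0) (\<sigma> \<alpha>)))"
    obtain U' where U': "U \<triangleright>\<^sup>* Mu U'" "?m [] U' \<triangleright>\<^sup>* V"
      using reds_ren_inv[OF U(1)] V unfolding Y by blast
    have below: "(U', U) \<in> below" using below_reds_child[OF U'(1) child.intros(4) U(1)] .
    have ren: "list_all2 (\<lambda>Y U. sn U \<and> Y \<in> clos U) (map (ren \<rho>' r') Zs) Ws"
      if "list_all2 (\<lambda>Y U. sn U \<and> Y \<in> clos U) Zs Ws" for Zs Ws \<rho>' r'
      using that by (auto simp: list.rel_map ren_clos elim!: list.rel_mono_strong)
    have "admissible U' (hole x As Bs)"
      unfolding admissible_def
    proof (intro allI impI ballI)
      \<comment> \<open>\<open>Z\<close> replaces the exposed argument. As \<open>W\<close> is below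
        \<open>U'\<close>, hence below \<open>U\<close>, the list of underlying terms decreases, and
        renaming keeps the other arguments closures of the same terms.\<close>
      fix W Z \<rho>' r' assume W: "(W, U') \<in> below" and Z: "Z \<in> clos W"
      have W': "(W, U) \<in> below" using W below by (rule below_trans)
      have "(As' @ W # Bs', Us) \<in> listrel1 below" unfolding Us using W' by (rule listrel1I) auto
      moreover have "list_all2 (\<lambda>Y U. sn U \<and> Y \<in> clos U)
          (map (ren \<rho>' r') As @ Z # map (ren \<rho>' r') Bs) (As' @ W # Bs')"
        using ren[OF As] ren[OF Bs] Z sn_below[OF W] by (intro list_all2_appendI) auto
      ultimately show "sn (plug (fmap (ren \<rho>' r') (hole x As Bs)) Z)"
        unfolding ren_hole plug_hole by (rule "1.IH")
    qed
    then have "admissible U' (fmap (lift_mu 0) (hole x As Bs))"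
      unfolding lift_mu0 by (rule admissible_ren)
    then have "?m (fmap (lift_mu 0) (hole x As Bs)) U' \<in> clos U'"
      by (rule clos_under_Mu[OF \<sigma> below])
    then have "sn (cap (hole x As Bs) (?m [] U'))"
      unfolding cap_under_Mu by (rule sn_clos[OF sn_below[OF below]])
    \<comment> \<open>Inversion gives a closure that reduces to \<open>V\<close> and need not equal
      it; reduction under \<open>cap\<close> closes the gap.\<close>
    then show "sn (cap (hole x As Bs) V)" by (rule sn_reds[OF reds_psub[OF U'(2)]])
  qed
qed

theorem theorem3p10:
  fixes x :: nat and Ms :: "trm list"
  assumes "\<forall>M \<in> set Ms. M \<in> SN"
  shows "apps (Var x) Ms \<in> SN"
proof -
  have "list_all2 (\<lambda>Y U. sn U \<and> Y \<in> clos U) Ms Ms"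
    using assms by (auto simp: SN_iff_sn clos_refl intro: list.rel_refl_strong)
  then show ?thesis unfolding SN_iff_sn by (rule sn_spine_clos)
qed

end
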